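(* Let $n\ge3$ and let $A\in\mathbb{R}^{n\times n}$ be a symmetric matrix with only two distinct eigenvalues, such that its smallest one has multiplicity one. Let $q_A:\mathbb{S}^{n-1}\cap\mathbb{R}^n_{++}\to\mathbb{R}$, $q_A(x)=\langle Ax,x\rangle$. Then $q_A$ is spherically quasi-convex if and only if there is an eigenvector of $A$ corresponding to the smallest eigenvalue with all components nonnegative.
   Context: $\langle\cdot,\cdot\rangle$ and $\|\cdot\|$ are the canonical inner product and norm on $\mathbb{R}^n$; $\mathbb{S}^{n-1}=\{x\in\mathbb{R}^n:\|x\|=1\}$ with intrinsic distance $d(x,y)=\arccos\langle x,y\rangle$; $\mathbb{R}^n_{++}$ is the set of vectors with all components positive. "Only two distinct eigenvalues" means exactly two distinct eigenvalues. A minimal geodesic segment is a constant-speed parametrized arc of a great circle whose length equals the distance $d$ between its endpoints. A set $\mathcal{C}\subseteq\mathbb{S}^{n-1}$ is spherically convex if for any $x,y\in\mathcal{C}$ all minimal geodesic segments joining $x$ to $y$ are contained in $\mathcal{C}$; $\mathbb{S}^{n-1}\cap\mathbb{R}^n_{++}$ is spherically convex. A function $f:\mathcal{C}\to\mathbb{R}$ on a spherically convex set is spherically quasi-convex if for every minimal geodesic segment $\gamma:I\to\mathcal{C}$ ($I\subset\mathbb{R}$ an interval), $f(\gamma(t))\le\max\{f(\gamma(t_1)),f(\gamma(t_2))\}$ for all $t\in[t_1,t_2]\subset I$. *)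

theory Defs
  imports "HOL-Analysis.Analysis" "HOL-Computational_Algebra.Polynomial"
begin

definition eigenvector :: "real ^ 'n ^ 'n \<Rightarrow> real \<Rightarrow> real ^ 'n \<Rightarrow> bool" where
  "eigenvector A l v \<longleftrightarrow> v \<noteq> 0 \<and> A *v v = l *\<^sub>R v"

definition eigenvalues :: "real ^ 'n ^ 'n \<Rightarrow> real set" where
  "eigenvalues A = {l. \<exists>v. eigenvector A l v}"

definition charpoly :: "real ^ 'n ^ 'n \<Rightarrow> real poly" where
  "charpoly A = det (mat [:0, 1:] - map_matrix (\<lambda>a. [:a:]) A)"

definition eigenvalue_multiplicity :: "real ^ 'n ^ 'n \<Rightarrow> real \<Rightarrow> nat" where
  "eigenvalue_multiplicity A l = order l (charpoly A)"

definition sphere_dist :: "'a::real_inner \<Rightarrow> 'a \<Rightarrow> real" where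
  "sphere_dist x y = arccos (x \<bullet> y)"

definition curve_length :: "(real \<Rightarrow> 'a::real_normed_vector) \<Rightarrow> real \<Rightarrow> real \<Rightarrow> real" where
  "curve_length \<gamma> a b = integral {a..b} (\<lambda>t. norm (vector_derivative \<gamma> (at t within {a..b})))"

text \<open>A rotation of the orthonormal pair \<open>p, v\<close> absorbs any phase, and replacing \<open>v\<close> by \<open>- v\<close> any
  sign of \<open>c\<close>. The speed is \<open>\<bar>c\<bar>\<close>; \<open>c = 0\<close> gives the degenerate (constant) arcs.\<close>

definition great_circle_arc :: "(real \<Rightarrow> 'a::real_inner) \<Rightarrow> real \<Rightarrow> real \<Rightarrow> bool" where
  "great_circle_arc \<gamma> a b \<longleftrightarrow> a \<le> b \<and>
    (\<exists>p v c. norm p = 1 \<and> norm v = 1 \<and> p \<bullet> v = 0 \<and>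
      (\<forall>t\<in>{a..b}. \<gamma> t = cos (c * t) *\<^sub>R p + sin (c * t) *\<^sub>R v))"

definition minimal_geodesic_segment :: "(real \<Rightarrow> 'a::real_inner) \<Rightarrow> real \<Rightarrow> real \<Rightarrow> bool" where
  "minimal_geodesic_segment \<gamma> a b \<longleftrightarrow>
    great_circle_arc \<gamma> a b \<and> curve_length \<gamma> a b = sphere_dist (\<gamma> a) (\<gamma> b)"

definition spherically_convex :: "'a::real_inner set \<Rightarrow> bool" where
  "spherically_convex C \<longleftrightarrow> C \<subseteq> sphere 0 1 \<and>
    (\<forall>x\<in>C. \<forall>y\<in>C. \<forall>\<gamma> a b. minimal_geodesic_segment \<gamma> a b \<and> \<gamma> a = x \<and> \<gamma> b = y
       \<longrightarrow> \<gamma> ` {a..b} \<subseteq> C)"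

text \<open>As in \<^const>\<open>convex_on\<close>, convexity of the domain is part of the definition.\<close>

definition spherically_quasi_convex_on :: "'a::real_inner set \<Rightarrow> ('a \<Rightarrow> real) \<Rightarrow> bool" where
  "spherically_quasi_convex_on C f \<longleftrightarrow> spherically_convex C \<and>
    (\<forall>\<gamma> a b. minimal_geodesic_segment \<gamma> a b \<and> \<gamma> ` {a..b} \<subseteq> C \<longrightarrow>
      (\<forall>t1\<in>{a..b}. \<forall>t2\<in>{a..b}. \<forall>t\<in>{t1..t2}. f (\<gamma> t) \<le> max (f (\<gamma> t1)) (f (\<gamma> t2))))"

definition positive_orthant :: "(real ^ 'n) set" where
  "positive_orthant = {x. \<forall>i. 0 < x $ i}"

end

theory Submission
  imports Defs
begin

text \<open>With \<open>l < m\<close> the eigenvalues and \<open>v\<close> a unit eigenvector for the simple eigenvalue \<open>l\<close>, the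
  form is \<open>m - (m - l) (v \<bullet> x)\<^sup>2\<close> on the sphere. If \<open>v \<ge> 0\<close>, then \<open>v \<bullet> x \<ge> 0\<close> on the orthant; an
  intermediate point of an arc shorter than \<open>pi\<close> is a combination of the two outer points with
  nonnegative coefficients of sum at least \<open>1\<close>, so \<open>v \<bullet> x\<close>, and with it its square, is
  quasi-concave along the arc. If \<open>v\<close> has entries of both signs, \<open>v \<bullet> x\<close> takes both signs on the
  orthant, and on an arc joining two such points the form reaches its maximum \<open>m\<close> where
  \<open>v \<bullet> x = 0\<close>, but not at the ends.\<close>

section \<open>Determinants and multiplicity in the characteristic polynomial\<close>

lemma det_column_mul:
  fixes A :: "'a::comm_ring_1^'n^'n"
  shows "det (\<chi> i j. if j = k then c * v $ i else A $ i $ j)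
       = c * det (\<chi> i j. if j = k then v $ i else A $ i $ j)"
proof -
  have "det (\<chi> i j. if j = k then c * v $ i else A $ i $ j)
      = det (transpose (\<chi> j. if j = k then c *s v else column j A))"
    by (rule arg_cong[where f = det]) (auto simp: vec_eq_iff transpose_def column_def)
  also have "\<dots> = c * det (transpose (\<chi> j. if j = k then v else column j A))"
    by (simp only: det_transpose det_row_mul)
  also have "transpose (\<chi> j. if j = k then v else column j A)
      = (\<chi> i j. if j = k then v $ i else A $ i $ j)"
    by (auto simp: vec_eq_iff transpose_def column_def)
  finally show ?thesis .
qed

text \<open>Evaluation at \<open>t\<close> is a ring homomorphism, so it commutes with the Leibniz
  sum. Polynomial determinants can thus be compared through real ones.\<close>

lemma poly_det:
  fixes M :: "'a::comm_ring_1 poly^'n^'n"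
  shows "poly (det M) t = det (map_matrix (\<lambda>p. poly p t) M)"
  by (simp add: det_def poly_sum poly_prod)

lemma poly_charpoly: "poly (charpoly A) t = det (mat t - A)"
proof -
  have "map_matrix (\<lambda>p. poly p t) (mat [:0, 1:] - map_matrix (\<lambda>a. [:a:]) A) = mat t - A"
    by (auto simp: vec_eq_iff mat_def)
  then show ?thesis
    unfolding charpoly_def poly_det by simp
qed

lemma mat_diff_mult_vec: "(mat t - A) *v x = t *\<^sub>R x - A *v x" for A :: "real^'n^'n"
proof -
  have "mat t = t *\<^sub>R (mat 1 :: real^'n^'n)"
    by (auto simp: vec_eq_iff mat_def)
  then show ?thesis
    by (simp add: matrix_vector_mult_diff_rdistrib flip: scaleR_matrix_vector_assoc)
qed

lemma uminus_matrix_vector_mult: "(- A) *v x = - (A *v x)" for A :: "real^'n^'m"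
  using matrix_vector_mult_diff_rdistrib[of 0 A x] by simp

text \<open>Cramer's rule is applied twice: trading column \<open>i\<close> for
  \<open>M *v u\<close>, and then column \<open>j\<close> of the new matrix for its product with
  \<open>w\<close>, brings out one factor \<open>s\<close> each time.\<close>

lemma det_two_eigenvector_columns:
  fixes M :: "real^'n^'n"
  assumes u: "M *v u = s *\<^sub>R u" and w: "M *v w = s *\<^sub>R w" and wi: "w $ i = 0"
  shows "u $ i * w $ j * det M
       = s\<^sup>2 * det (\<chi> a c. if c = j then w $ a else if c = i then u $ a else M $ a $ c)"
proof -
  define M' :: "real^'n^'n" where "M' = (\<chi> a c. if c = i then u $ a else M $ a $ c)"
  have "u $ i * det M = det (\<chi> a c. if c = i then s * u $ a else M $ a $ c)"
    using cramer_lemma[of i M u] unfolding u by (simp cong: if_cong)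
  also have "\<dots> = s * det M'"
    unfolding M'_def by (rule det_column_mul)
  finally have 1: "u $ i * det M = s * det M'" .
  \<comment> \<open>Column \<open>i\<close>, the only one that was replaced, is weighted by
    \<open>w $ i = 0\<close>, so the equation for \<open>w\<close> survives the replacement.\<close>
  have "(M' *v w) $ a = (M *v w) $ a" for a
    unfolding matrix_vector_mult_def M'_def using wi by (auto intro!: sum.cong)
  then have w': "M' *v w = s *\<^sub>R w"
    using w by (simp add: vec_eq_iff)
  have "w $ j * det M' = det (\<chi> a c. if c = j then s * w $ a else M' $ a $ c)"
    using cramer_lemma[of j M' w] unfolding w' by (simp cong: if_cong)
  also have "\<dots> = s * det (\<chi> a c. if c = j then w $ a else M' $ a $ c)"
    by (rule det_column_mul)
  finally have 2: "w $ j * det M' = s * det (\<chi> a c. if c = j then w $ a else M' $ a $ c)" .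
  have "u $ i * w $ j * det M = s * (w $ j * det M')"
    using 1 by (simp add: algebra_simps)
  also have "\<dots> = s\<^sup>2 * det (\<chi> a c. if c = j then w $ a else M' $ a $ c)"
    by (simp add: 2 power2_eq_square)
  finally show ?thesis
    by (simp add: M'_def cong: if_cong)
qed

text \<open>Substituting two eigenvectors for columns of \<open>mat t - A\<close> by Cramer's rule extracts one factor
  \<open>t - l\<close> each; this needs neither a change of basis nor the spectral theorem.\<close>

lemma charpoly_square_dvd:
  fixes A :: "real^'n^'n"
  assumes u: "A *v u = l *\<^sub>R u" and w: "A *v w = l *\<^sub>R w"
    and i: "u $ i \<noteq> 0" "w $ i = 0" and "w \<noteq> 0"
  shows "[:- l, 1:]\<^sup>2 dvd charpoly A"
proof -
  obtain j where j: "w $ j \<noteq> 0"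
    using \<open>w \<noteq> 0\<close> by (auto simp: vec_eq_iff)
  \<comment> \<open>\<open>h\<close> is the cofactor left once both factors are extracted: the
    determinant with the two columns already replaced, kept as a polynomial.\<close>
  define h where "h = det (\<chi> a c. if c = j then [:w $ a:] else if c = i then [:u $ a:]
    else (mat [:0, 1:] - map_matrix (\<lambda>a. [:a:]) A) $ a $ c)"
  have "poly (smult (u $ i * w $ j) (charpoly A)) t = poly ([:- l, 1:]\<^sup>2 * h) t" for t
  proof -
    have "poly h t
        = det (\<chi> a c. if c = j then w $ a else if c = i then u $ a else (mat t - A) $ a $ c)"
      unfolding h_def poly_det
      by (rule arg_cong[where f = det]) (auto simp: vec_eq_iff mat_def)
    moreover have "(mat t - A) *v u = (t - l) *\<^sub>R u" "(mat t - A) *v w = (t - l) *\<^sub>R w"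
      by (simp_all add: mat_diff_mult_vec u w scaleR_diff_left)
    ultimately show ?thesis
      using det_two_eigenvector_columns[of "mat t - A" u "t - l" w i j] i
      by (simp add: poly_charpoly)
  qed
  then have "smult (u $ i * w $ j) (charpoly A) = [:- l, 1:]\<^sup>2 * h"
    by (metis poly_eq_poly_eq_iff ext)
  then have "[:- l, 1:]\<^sup>2 dvd smult (u $ i * w $ j) (charpoly A)"
    by simp
  then show ?thesis
    using i j by (simp add: dvd_smult_iff)
qed

lemma poly_charpoly_eq_0_iff: "poly (charpoly A) t = 0 \<longleftrightarrow> t \<in> eigenvalues A"
proof -
  have "det (mat t - A) = 0 \<longleftrightarrow> \<not> (\<forall>x. (mat t - A) *v x = 0 \<longrightarrow> x = 0)"
    by (metis invertible_det_nz invertible_left_inverse matrix_left_invertible_ker)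
  then show ?thesis
    by (auto simp: poly_charpoly eigenvalues_def eigenvector_def mat_diff_mult_vec)
qed

text \<open>An eigenvector independent of \<open>u\<close> would make \<open>l\<close> a double root
  of the characteristic polynomial. Finiteness of the spectrum enters because \<open>order\<close>
  bounds divisibility only for a nonzero polynomial.\<close>

lemma simple_eigenvalue_unique_eigenvector:
  assumes fin: "finite (eigenvalues A)" and mult: "eigenvalue_multiplicity A l = 1"
    and u: "eigenvector A l u" and w: "A *v w = l *\<^sub>R w"
  obtains c where "w = c *\<^sub>R u"
proof -
  \<comment> \<open>A real number outside the finite spectrum is not a root, so the characteristic
    polynomial is not zero.\<close>
  obtain t where "t \<notin> eigenvalues A"
    using ex_new_if_finite[OF infinite_UNIV_char_0 fin] by blast
  then have nz: "charpoly A \<noteq> 0"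
    using poly_charpoly_eq_0_iff[of A t] by auto
  obtain i where i: "u $ i \<noteq> 0"
    using u by (auto simp: eigenvector_def vec_eq_iff)
  \<comment> \<open>Subtracting this multiple of \<open>u\<close> clears entry \<open>i\<close>, as
    \<open>charpoly_square_dvd\<close> demands; \<open>w'\<close> must then vanish.\<close>
  define w' where "w' = w - (w $ i / u $ i) *\<^sub>R u"
  have "A *v w' = l *\<^sub>R w'" "w' $ i = 0"
    using u w i
    by (simp_all add: w'_def eigenvector_def algebra_simps matrix_vector_mult_diff_distrib)
  then have "w' = 0"
    using charpoly_square_dvd[of A u l w' i] u i nz mult
    by (auto simp: eigenvector_def eigenvalue_multiplicity_def order_divides)
  then show thesis
    using that w'_def by auto
qed

section \<open>Rayleigh quotients and the spectral form of a symmetric matrix\<close>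

lemma nonneg_quadratic_imp_linear_coeff_0:
  fixes a b :: real
  assumes "\<And>s. 0 \<le> s * a + s\<^sup>2 * b"
  shows "a = 0"
proof (rule ccontr)
  assume a: "a \<noteq> 0"
  define d where "d = \<bar>b\<bar> + 1"
  have d: "d > 0" "b < d" by (auto simp: d_def)
  \<comment> \<open>For \<open>s = - a / d\<close> the linear term loses \<open>a * a / d\<close>,
    and since \<open>b < d\<close> the quadratic term cannot make up for it.\<close>
  have "0 \<le> (- a / d) * a + (- a / d)\<^sup>2 * b" by (rule assms)
  also have "\<dots> = (a\<^sup>2 / d) * (b / d - 1)"
    using d by (simp add: field_simps power2_eq_square)
  also have "\<dots> < 0"
    using a d by (intro mult_pos_neg) auto
  finally show False by simp
qed

lemma symmetric_inner_commute:
  fixes A :: "real^'n^'n"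
  assumes "transpose A = A"
  shows "x \<bullet> (A *v y) = y \<bullet> (A *v x)"
  by (metis assms dot_lmul_matrix inner_commute vector_transpose_matrix)

text \<open>The form attains its maximum \<open>m\<close> on the compact unit sphere of
  \<open>W\<close>. The first-order condition at a maximiser \<open>z\<close>, taken along the
  residual of the eigenvalue equation, forces that residual to vanish.\<close>

lemma symmetric_max_eigenvector_on_subspace:
  fixes A :: "real^'n^'n"
  assumes sym: "transpose A = A" and W: "subspace W" and inv: "\<And>x. x \<in> W \<Longrightarrow> A *v x \<in> W"
    and "\<exists>x\<in>W. x \<noteq> 0"
  obtains m z where "z \<in> W" "eigenvector A m z" "\<And>y. y \<in> W \<Longrightarrow> y \<bullet> (A *v y) \<le> m * (y \<bullet> y)"
proof -
  have "compact (W \<inter> sphere 0 1)"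
    using W by (metis closed_subspace closed_Int_compact compact_sphere)
  moreover obtain x0 where "x0 \<in> W" "x0 \<noteq> 0" using assms(4) by blast
  then have "(1 / norm x0) *\<^sub>R x0 \<in> W \<inter> sphere 0 1"
    using W by (auto simp: subspace_scale)
  then have "W \<inter> sphere 0 1 \<noteq> {}" by blast
  moreover have "continuous_on (W \<inter> sphere 0 1) (\<lambda>y. y \<bullet> (A *v y))"
    by (intro continuous_intros)
  ultimately obtain z where z: "z \<in> W \<inter> sphere 0 1"
    and max: "\<And>y. y \<in> W \<inter> sphere 0 1 \<Longrightarrow> y \<bullet> (A *v y) \<le> z \<bullet> (A *v z)"
    using continuous_attains_sup by metis
  define m where "m = z \<bullet> (A *v z)"
  have zz: "z \<bullet> z = 1" using z by (simp add: norm_eq_1)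
  have le: "y \<bullet> (A *v y) \<le> m * (y \<bullet> y)" if "y \<in> W" for y
  proof (cases "y = 0")
    case False
    have "(1 / norm y) *\<^sub>R y \<in> W \<inter> sphere 0 1"
      using W that False by (auto simp: subspace_scale)
    from max[OF this] have "(y \<bullet> (A *v y)) / (norm y)\<^sup>2 \<le> m"
      by (simp add: m_def matrix_vector_mult_scaleR power2_eq_square)
    then show ?thesis
      using False by (simp add: dot_square_norm field_simps)
  qed simp
  note sym' = symmetric_inner_commute[OF sym]
  \<comment> \<open>\<open>g\<close> is the residual, proportional to the gradient at
    \<open>z\<close>; invariance of \<open>W\<close> makes it an admissible direction.\<close>
  define g where "g = m *\<^sub>R z - A *v z"
  have gW: "g \<in> W"
    using z W inv by (auto simp: g_def subspace_diff subspace_scale)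
  \<comment> \<open>This is the maximality inequality at \<open>z + s *\<^sub>R g\<close>, expanded
    in \<open>s\<close>. Its constant term cancels because \<open>z\<close> is a unit vector with
    value \<open>m\<close>.\<close>
  have "0 \<le> s * (2 * (g \<bullet> g)) + s\<^sup>2 * (m * (g \<bullet> g) - g \<bullet> (A *v g))" for s
  proof -
    have "z + s *\<^sub>R g \<in> W" using z gW W by (auto simp: subspace_add subspace_scale)
    from le[OF this] have "0 \<le> m * ((z + s *\<^sub>R g) \<bullet> (z + s *\<^sub>R g))
        - (z + s *\<^sub>R g) \<bullet> (A *v (z + s *\<^sub>R g))" by simp
    also have "\<dots> = s * (2 * (m * (g \<bullet> z) - g \<bullet> (A *v z))) + s\<^sup>2 * (m * (g \<bullet> g) - g \<bullet> (A *v g))"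
      using zz by (simp add: matrix_vector_right_distrib matrix_vector_mult_scaleR inner_add_left
          inner_add_right m_def[symmetric] sym'[of z g] inner_commute[of z g]
          power2_eq_square algebra_simps)
    also have "m * (g \<bullet> z) - g \<bullet> (A *v z) = g \<bullet> g"
      unfolding g_def by (simp add: inner_diff_right)
    finally show ?thesis .
  qed
  then have "2 * (g \<bullet> g) = 0" by (rule nonneg_quadratic_imp_linear_coeff_0)
  then have "A *v z = m *\<^sub>R z" by (simp add: g_def)
  with z zz le show thesis
    by (intro that[of z m]) (auto simp: eigenvector_def)
qed

text \<open>On the orthogonal complement of \<open>v\<close>, the maximum and the minimum of the Rayleigh quotient are
  eigenvalues with eigenvectors orthogonal to \<open>v\<close>, so both equal \<open>m\<close>.\<close>

lemma symmetric_rank_one_decomposition: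
  fixes A :: "real^'n^'n"
  assumes sym: "transpose A = A" and ev: "eigenvalues A = {l, m}"
    and mult: "eigenvalue_multiplicity A l = 1"
    and v: "eigenvector A l v" and vv: "v \<bullet> v = 1"
  shows "(A *v x) \<bullet> x = m * (x \<bullet> x) + (l - m) * (v \<bullet> x)\<^sup>2"
proof -
  note sym' = symmetric_inner_commute[OF sym]
  have Av: "A *v v = l *\<^sub>R v" using v by (simp add: eigenvector_def)
  define W where "W = {x. v \<bullet> x = 0}"
  have W: "subspace W" unfolding W_def by (rule subspace_hyperplane)
  have inv: "A *v x \<in> W" if "x \<in> W" for x
    using that sym'[of v x] by (simp add: W_def Av inner_commute)
  \<comment> \<open>An eigenvector for \<open>l\<close> would be a multiple of \<open>v\<close>,
    hence could not be both nonzero and orthogonal to \<open>v\<close>.\<close>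
  have only_m: "k = m" if "z \<in> W" "eigenvector A k z" for k z
  proof (rule ccontr)
    assume "k \<noteq> m"
    with that ev have "k = l" by (auto simp: eigenvalues_def)
    with that obtain c where "z = c *\<^sub>R v"
      using simple_eigenvalue_unique_eigenvector[OF _ mult v, of z] ev
      by (auto simp: eigenvector_def)
    with that vv show False by (auto simp: W_def eigenvector_def)
  qed
  have onW: "y \<bullet> (A *v y) = m * (y \<bullet> y)" if y: "y \<in> W" for y
  proof (cases "y = 0")
    case False
    then have ex: "\<exists>x\<in>W. x \<noteq> 0" using y by blast
    have "y \<bullet> (A *v y) \<le> m * (y \<bullet> y)"
      using symmetric_max_eigenvector_on_subspace[OF sym W inv ex] only_m y by metis
    moreover have sym_neg: "transpose (- A) = - A"
      using sym by (simp add: vec_eq_iff transpose_def)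
    have inv_neg: "- A *v x \<in> W" if "x \<in> W" for x
      using inv[OF that] W by (simp add: uminus_matrix_vector_mult subspace_neg)
    \<comment> \<open>The lower bound on \<open>W\<close> comes from the maximum for
      \<open>- A\<close>, whose eigenvalue there can only be \<open>- m\<close>.\<close>
    obtain k z where z: "z \<in> W" "eigenvector (- A) k z"
      and max: "\<And>y. y \<in> W \<Longrightarrow> y \<bullet> (- A *v y) \<le> k * (y \<bullet> y)"
      using symmetric_max_eigenvector_on_subspace[OF sym_neg W inv_neg ex] by blast
    from z have "eigenvector A (- k) z"
      by (auto simp: eigenvector_def uminus_matrix_vector_mult minus_equation_iff[of "A *v z"])
    with only_m z have "k = - m" by fastforce
    with max[OF y] have "m * (y \<bullet> y) \<le> y \<bullet> (A *v y)"
      by (simp add: uminus_matrix_vector_mult)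
    ultimately show ?thesis by simp
  qed simp
  \<comment> \<open>\<open>x\<close> is split into its part along \<open>v\<close> and its part in
    \<open>W\<close>; orthogonality and the invariance of \<open>W\<close> remove the cross
    terms.\<close>
  define y where "y = x - (v \<bullet> x) *\<^sub>R v"
  have yW: "v \<bullet> y = 0" using vv by (simp add: y_def inner_diff_right)
  then have "y \<bullet> (A *v y) = m * (y \<bullet> y)" using onW by (simp add: W_def)
  moreover have vy: "v \<bullet> (A *v y) = 0" using inv yW by (simp add: W_def)
  have x: "x = (v \<bullet> x) *\<^sub>R v + y" by (simp add: y_def)
  have "x \<bullet> x = (v \<bullet> x)\<^sup>2 + y \<bullet> y"
    by (subst x, subst (2) x, simp only: inner_add_left inner_add_right)
      (simp add: vv yW inner_commute[of y v] power2_eq_square)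
  moreover have "x \<bullet> (A *v x) = l * (v \<bullet> x)\<^sup>2 + y \<bullet> (A *v y)"
    by (subst x, subst (2) x,
        simp only: inner_add_left inner_add_right matrix_vector_right_distrib matrix_vector_mult_scaleR)
      (simp add: vv vy Av yW inner_commute[of y v] power2_eq_square)
  ultimately show ?thesis
    by (simp add: inner_commute algebra_simps)
qed

section \<open>Great circle arcs and minimal geodesic segments\<close>

lemma curve_length_great_circle_arc:
  fixes p v :: "'a::euclidean_space"
  assumes ab: "a \<le> b" and on: "norm p = 1" "norm v = 1" "p \<bullet> v = 0"
    and \<gamma>: "\<And>t. t \<in> {a..b} \<Longrightarrow> \<gamma> t = cos (c * t) *\<^sub>R p + sin (c * t) *\<^sub>R v"
  shows "curve_length \<gamma> a b = \<bar>c\<bar> * (b - a)"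
proof (cases "a = b")
  \<comment> \<open>Within a one-point interval the derivative is not determined, but the integral
    is zero in any case.\<close>
  case True
  then show ?thesis by (simp add: curve_length_def)
next
  case False
  with ab have "a < b" by simp
  have speed: "norm (vector_derivative \<gamma> (at t within {a..b})) = \<bar>c\<bar>" if t: "t \<in> {a..b}" for t
  proof -
    have "((\<lambda>t. cos (c * t) *\<^sub>R p + sin (c * t) *\<^sub>R v) has_vector_derivative
        (- c * sin (c * t)) *\<^sub>R p + (c * cos (c * t)) *\<^sub>R v) (at t within {a..b})"
      by (auto intro!: derivative_eq_intros simp: algebra_simps)
    then have "(\<gamma> has_vector_derivative
        (- c * sin (c * t)) *\<^sub>R p + (c * cos (c * t)) *\<^sub>R v) (at t within {a..b})"
      by (rule has_vector_derivative_transform[OF t, rotated]) (use \<gamma> in auto)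
    then have "vector_derivative \<gamma> (at t within {a..b})
        = (- c * sin (c * t)) *\<^sub>R p + (c * cos (c * t)) *\<^sub>R v"
      using vector_derivative_within_closed_interval[OF \<open>a < b\<close> t] by blast
    moreover have "(norm ((- c * sin (c * t)) *\<^sub>R p + (c * cos (c * t)) *\<^sub>R v))\<^sup>2 = \<bar>c\<bar>\<^sup>2"
    proof -
      have "p \<bullet> p = 1" "v \<bullet> v = 1" "v \<bullet> p = 0"
        using on by (auto simp: norm_eq_1 inner_commute)
      then have "(norm ((- c * sin (c * t)) *\<^sub>R p + (c * cos (c * t)) *\<^sub>R v))\<^sup>2
        = c\<^sup>2 * ((sin (c * t))\<^sup>2 + (cos (c * t))\<^sup>2)"
        using on(3) unfolding power2_norm_eq_inner
        by (simp add: inner_add_left inner_add_right power2_eq_square algebra_simps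
            del: sin_cos_squared_add sin_cos_squared_add2 sin_cos_squared_add3)
      then show ?thesis by simp
    qed
    ultimately show ?thesis
      by (metis abs_ge_zero norm_ge_zero power2_eq_iff_nonneg)
  qed
  have "curve_length \<gamma> a b = integral {a..b} (\<lambda>t. \<bar>c\<bar>)"
    unfolding curve_length_def by (intro integral_cong) (use speed in auto)
  then show ?thesis using ab by simp
qed

lemma inner_great_circle:
  assumes "norm p = 1" "norm v = 1" "p \<bullet> v = 0"
  shows "(cos s *\<^sub>R p + sin s *\<^sub>R v) \<bullet> (cos t *\<^sub>R p + sin t *\<^sub>R v) = cos (t - s)"
proof -
  have "p \<bullet> p = 1" "v \<bullet> v = 1" "v \<bullet> p = 0"
    using assms by (auto simp: norm_eq_1 inner_commute)
  then show ?thesis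
    using assms(3) by (simp add: inner_add_left inner_add_right cos_diff algebra_simps)
qed

text \<open>Spherical linear interpolation with its denominator cleared. Only the coefficients of
  \<open>p\<close> and \<open>v\<close> are compared, so the identity holds for arbitrary vectors
  and angles.\<close>

lemma sine_interpolation:
  fixes p v :: "'a::real_vector" and r s t :: real
  defines "g \<equiv> \<lambda>x. cos x *\<^sub>R p + sin x *\<^sub>R v"
  shows "sin (t - r) *\<^sub>R g s = sin (t - s) *\<^sub>R g r + sin (s - r) *\<^sub>R g t"
proof -
  have "sin (t - r) * cos s = sin (t - s) * cos r + sin (s - r) * cos t"
    "sin (t - r) * sin s = sin (t - s) * sin r + sin (s - r) * sin t"
    using sin_cos_squared_add[of s] sin_cos_squared_add[of r] sin_cos_squared_add[of t]
    unfolding sin_diff by algebra+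
  then show ?thesis
    by (simp add: g_def algebra_simps flip: scaleR_add_left)
qed

text \<open>In the addition formula the cosines are at most 1 and the sines nonnegative. The bound
  is what makes the interpolation coefficients sum to at least 1.\<close>

lemma sin_add_le_sin_plus_sin:
  fixes x y :: real
  assumes "0 \<le> x" "x \<le> pi" "0 \<le> y" "y \<le> pi"
  shows "sin (x + y) \<le> sin x + sin y"
proof -
  have "sin x * cos y \<le> sin x" "cos x * sin y \<le> sin y"
    using assms mult_right_mono[of "cos x" 1 "sin y"] mult_left_mono[of "cos y" 1 "sin x"]
    by (simp_all add: sin_ge_zero)
  then show ?thesis by (simp add: sin_add)
qed

text \<open>A positive inner product of the ends keeps the arc shorter than \<open>pi\<close>, so
  the interpolation formula has nonnegative sines and may be divided by the sine of a nonzero outer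
  angle. The bound \<open>1 \<le> \<alpha> + \<beta>\<close> says that the arc bulges beyond the
  chord.\<close>

lemma minimal_geodesic_segment_interpolation:
  fixes \<gamma> :: "real \<Rightarrow> 'a::euclidean_space"
  assumes geo: "minimal_geodesic_segment \<gamma> a b" and pos: "\<gamma> a \<bullet> \<gamma> b > 0"
    and ord: "a \<le> t1" "t1 \<le> t" "t \<le> t2" "t2 \<le> b"
  obtains \<alpha> \<beta> where "0 \<le> \<alpha>" "0 \<le> \<beta>" "1 \<le> \<alpha> + \<beta>" "\<gamma> t = \<alpha> *\<^sub>R \<gamma> t1 + \<beta> *\<^sub>R \<gamma> t2"
proof -
  from geo obtain p v c where ab: "a \<le> b" and on: "norm p = 1" "norm v = 1" "p \<bullet> v = 0"
    and \<gamma>: "\<And>t. t \<in> {a..b} \<Longrightarrow> \<gamma> t = cos (c * t) *\<^sub>R p + sin (c * t) *\<^sub>R v"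
    and len: "curve_length \<gamma> a b = sphere_dist (\<gamma> a) (\<gamma> b)"
    unfolding minimal_geodesic_segment_def great_circle_arc_def by blast
  have inner: "\<gamma> a \<bullet> \<gamma> b = cos (c * b - c * a)"
    using inner_great_circle[OF on] \<gamma> ab by simp
  define L where "L = \<bar>c\<bar> * (b - a)"
  \<comment> \<open>Minimality turns the length of the arc into the angle between its ends.\<close>
  have L: "L = arccos (\<gamma> a \<bullet> \<gamma> b)"
    using len curve_length_great_circle_arc[OF ab on \<gamma>] by (simp add: sphere_dist_def L_def)
  have "arccos (\<gamma> a \<bullet> \<gamma> b) < arccos 0"
    using pos inner by (intro arccos_less_mono[THEN iffD2]) auto
  then have Lpi: "L < pi" unfolding L arccos_0 using pi_gt_zero by linarith
  \<comment> \<open>The sign of \<open>c\<close> is moved into the vector \<open>v\<close>, so that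
    angles increase with the parameter.\<close>
  define \<sigma> where "\<sigma> = (if c < 0 then - 1 else 1 :: real)"
  have g: "\<gamma> s = cos (\<bar>c\<bar> * s) *\<^sub>R p + sin (\<bar>c\<bar> * s) *\<^sub>R (\<sigma> *\<^sub>R v)" if "s \<in> {a..b}" for s
    using \<gamma>[OF that] by (auto simp: \<sigma>_def)
  define x y where "x = \<bar>c\<bar> * t - \<bar>c\<bar> * t1" and "y = \<bar>c\<bar> * t2 - \<bar>c\<bar> * t"
  have x0: "0 \<le> x" and y0: "0 \<le> y"
    using ord by (auto simp: x_def y_def mult_left_mono)
  have "x + y = \<bar>c\<bar> * (t2 - t1)" by (simp add: x_def y_def algebra_simps)
  also have "\<dots> \<le> L" unfolding L_def using ord by (intro mult_left_mono) auto
  finally have xy: "x + y < pi" using Lpi by simp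
  show thesis
  proof (cases "x + y = 0")
    \<comment> \<open>The outer angle is zero, as on constant arcs; the formula cannot be divided,
      but the two points coincide.\<close>
    case True
    then have "\<bar>c\<bar> * t = \<bar>c\<bar> * t1" using x0 y0 unfolding x_def by linarith
    then have "\<gamma> t = 1 *\<^sub>R \<gamma> t1 + 0 *\<^sub>R \<gamma> t2"
      using g[of t] g[of t1] ord by auto
    then show thesis by (intro that[of 1 0]) auto
  next
    case False
    define S where "S = sin (x + y)"
    have S: "S > 0" unfolding S_def using False x0 y0 xy by (intro sin_gt_zero) auto
    have eq: "S *\<^sub>R \<gamma> t = sin y *\<^sub>R \<gamma> t1 + sin x *\<^sub>R \<gamma> t2"
      using sine_interpolation[of "\<bar>c\<bar> * t2" "\<bar>c\<bar> * t1" "\<bar>c\<bar> * t" p "\<sigma> *\<^sub>R v"] g ord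
      by (simp add: S_def x_def y_def)
    have "\<gamma> t = (1 / S) *\<^sub>R (S *\<^sub>R \<gamma> t)" using S by simp
    then have "\<gamma> t = (sin y / S) *\<^sub>R \<gamma> t1 + (sin x / S) *\<^sub>R \<gamma> t2"
      unfolding eq by (simp add: scaleR_add_right)
    moreover have "S \<le> sin x + sin y"
      unfolding S_def using x0 y0 xy by (intro sin_add_le_sin_plus_sin) auto
    then have "1 \<le> sin y / S + sin x / S"
      using S by (simp add: field_simps)
    moreover have "0 \<le> sin x" "0 \<le> sin y"
      using x0 y0 xy by (auto intro!: sin_ge_zero)
    ultimately show thesis using S by (intro that) auto
  qed
qed

text \<open>Gram-Schmidt on \<open>x\<close> and \<open>y\<close> yields the unit-speed arc. The
  assumptions exclude equal and antipodal points, where \<open>S\<close> would vanish.\<close>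

lemma minimal_geodesic_segment_exists:
  fixes x y :: "'a::euclidean_space"
  assumes "norm x = 1" "norm y = 1" "x \<bullet> y > 0" "x \<noteq> y"
  obtains \<gamma> b where "minimal_geodesic_segment \<gamma> 0 b" "\<gamma> 0 = x" "\<gamma> b = y" "0 \<le> b"
    "continuous_on {0..b} \<gamma>"
proof -
  define k where "k = x \<bullet> y"
  have xx: "x \<bullet> x = 1" and yy: "y \<bullet> y = 1" using assms by (auto simp: norm_eq_1)
  have "k \<le> 1" using norm_cauchy_schwarz[of x y] assms by (simp add: k_def)
  moreover have "k \<noteq> 1"
    using assms norm_cauchy_schwarz_eq[of x y] by (simp add: k_def)
  ultimately have k: "0 < k" "k < 1" using assms by (auto simp: k_def)
  \<comment> \<open>With \<open>k\<close> the cosine of the angle between \<open>x\<close> and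
    \<open>y\<close>, \<open>S\<close> is its sine and the norm of the part of \<open>y\<close>
    orthogonal to \<open>x\<close>.\<close>
  define S where "S = sqrt (1 - k\<^sup>2)"
  have "k\<^sup>2 < 1" using k by (simp add: abs_square_less_1)
  then have S: "S > 0" "S\<^sup>2 = 1 - k\<^sup>2" by (auto simp: S_def)
  define v where "v = (1 / S) *\<^sub>R (y - k *\<^sub>R x)"
  have xv: "x \<bullet> v = 0" by (simp add: v_def inner_diff_right xx k_def)
  have "(y - k *\<^sub>R x) \<bullet> (y - k *\<^sub>R x) = S * S"
    unfolding S(2)[unfolded power2_eq_square] using xx yy
    by (simp add: inner_diff_left inner_diff_right inner_commute[of y x] k_def power2_eq_square)
  then have "v \<bullet> v = 1" using S(1) by (simp add: v_def)
  then have nv: "norm v = 1" by (simp add: norm_eq_1)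
  define b where "b = arccos k"
  have b: "0 \<le> b" "cos b = k" "sin b = S"
    using k by (auto simp: b_def S_def arccos_lbound cos_arccos sin_arccos)
  \<comment> \<open>The factor \<open>1\<close> is the speed \<open>c\<close>, written out to match
    the shape in \<open>great_circle_arc\<close>.\<close>
  define \<gamma> where "\<gamma> = (\<lambda>t. cos (1 * t) *\<^sub>R x + sin (1 * t) *\<^sub>R v)"
  have ends: "\<gamma> 0 = x" "\<gamma> b = y"
    using b S by (simp_all add: \<gamma>_def v_def)
  have "great_circle_arc \<gamma> 0 b"
    unfolding great_circle_arc_def \<gamma>_def using b assms(1) nv xv by blast
  moreover have "curve_length \<gamma> 0 b = sphere_dist (\<gamma> 0) (\<gamma> b)"
    using curve_length_great_circle_arc[of 0 b x v \<gamma> 1] b assms(1) nv xv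
    unfolding ends sphere_dist_def by (simp add: b_def k_def \<gamma>_def)
  moreover have "continuous_on {0..b} \<gamma>"
    unfolding \<gamma>_def by (intro continuous_intros)
  ultimately show thesis
    using that ends b by (simp add: minimal_geodesic_segment_def)
qed

lemma norm_minimal_geodesic_segment:
  assumes "minimal_geodesic_segment \<gamma> a b" "t \<in> {a..b}"
  shows "norm (\<gamma> t) = 1"
proof -
  from assms obtain p v c where on: "norm p = 1" "norm v = 1" "p \<bullet> v = 0"
    and "\<gamma> t = cos (c * t) *\<^sub>R p + sin (c * t) *\<^sub>R v"
    unfolding minimal_geodesic_segment_def great_circle_arc_def by blast
  then show ?thesis
    using inner_great_circle[OF on, of "c * t" "c * t"] by (simp add: norm_eq_1)
qed

section \<open>Geometry of the positive orthant\<close>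

lemma inner_pos_of_positive_orthant:
  fixes x y :: "real^'n"
  assumes "x \<in> positive_orthant" "y \<in> positive_orthant"
  shows "x \<bullet> y > 0"
  using assms by (auto simp: positive_orthant_def inner_vec_def intro!: sum_pos)

text \<open>The ends have positive inner product, so interpolation applies; its nonnegative
  coefficients are not both zero, which keeps every component positive.\<close>

lemma spherically_convex_positive_orthant:
  "spherically_convex (sphere 0 1 \<inter> (positive_orthant :: (real^'n) set))"
  unfolding spherically_convex_def
proof (intro conjI ballI allI impI)
  fix x y :: "real^'n" and \<gamma> a b
  assume xy: "x \<in> sphere 0 1 \<inter> positive_orthant" "y \<in> sphere 0 1 \<inter> positive_orthant"
    and geo: "minimal_geodesic_segment \<gamma> a b \<and> \<gamma> a = x \<and> \<gamma> b = y"
  show "\<gamma> ` {a..b} \<subseteq> sphere 0 1 \<inter> positive_orthant"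
  proof (rule image_subsetI)
    fix t assume t: "t \<in> {a..b}"
    have pos: "\<gamma> a \<bullet> \<gamma> b > 0"
      using xy geo inner_pos_of_positive_orthant by auto
    obtain \<alpha> \<beta> where *: "0 \<le> \<alpha>" "0 \<le> \<beta>" "1 \<le> \<alpha> + \<beta>" "\<gamma> t = \<alpha> *\<^sub>R \<gamma> a + \<beta> *\<^sub>R \<gamma> b"
      using minimal_geodesic_segment_interpolation[of \<gamma> a b a t b] geo pos t by auto
    have "0 < \<gamma> t $ i" for i
    proof -
      have "0 < x $ i" "0 < y $ i" using xy by (auto simp: positive_orthant_def)
      moreover have "0 < \<alpha> \<or> 0 < \<beta>" using * by linarith
      ultimately show ?thesis
        using * geo by (auto intro: add_pos_nonneg add_nonneg_pos)
    qed
    then show "\<gamma> t \<in> sphere 0 1 \<inter> positive_orthant"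
      using norm_minimal_geodesic_segment[of \<gamma> a b t] geo t by (simp add: positive_orthant_def)
  qed
qed simp

text \<open>The axis vector of \<open>i\<close> pairs positively with \<open>v\<close> but may lie
  on the boundary of the orthant; a small shift along the all-ones vector moves it inside.\<close>

lemma inner_pos_point_in_positive_orthant:
  fixes v :: "real^'n"
  assumes "v $ i > 0"
  obtains x where "norm x = 1" "x \<in> positive_orthant" "v \<bullet> x > 0"
proof -
  define s where "s = (\<Sum>j\<in>UNIV. v $ j)"
  \<comment> \<open>The shift changes the inner product by \<open>e * s\<close>; this
    \<open>e\<close> gives \<open>e * \<bar>s\<bar> < v $ i\<close>, and the summand 1 also covers
    \<open>s = 0\<close>.\<close>
  define e where "e = v $ i / (\<bar>s\<bar> + 1)"
  have e: "e > 0" using assms by (simp add: e_def)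
  have "e * \<bar>s\<bar> < v $ i"
    using assms by (simp add: e_def divide_less_eq field_simps)
  moreover have "\<bar>e * s\<bar> = e * \<bar>s\<bar>" using e by (simp add: abs_mult)
  ultimately have es: "0 < v $ i + e * s" by linarith
  define z where "z = axis i 1 + e *\<^sub>R (1 :: real^'n)"
  have z: "0 < z $ j" for j using e by (simp add: z_def axis_def)
  then have "z \<noteq> 0" by (metis less_irrefl zero_index)
  have "v \<bullet> z = v $ i + e * s"
    by (simp add: z_def inner_add_right inner_axis s_def) (simp add: inner_vec_def)
  then show thesis
    using that[of "(1 / norm z) *\<^sub>R z"] z es \<open>z \<noteq> 0\<close> by (simp add: positive_orthant_def)
qed

theorem theorem4:
  fixes A :: "real ^ 'n ^ 'n"
  assumes "CARD('n) \<ge> 3"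
    and "transpose A = A"
    and "card (eigenvalues A) = 2"
    and "eigenvalue_multiplicity A (Min (eigenvalues A)) = 1"
  shows "spherically_quasi_convex_on (sphere 0 1 \<inter> positive_orthant) (\<lambda>x. (A *v x) \<bullet> x)
    \<longleftrightarrow> (\<exists>v. eigenvector A (Min (eigenvalues A)) v \<and> (\<forall>i. 0 \<le> v $ i))"
proof -
  define l where "l = Min (eigenvalues A)"
  have fin: "finite (eigenvalues A)"
    using assms(3) by (metis card.infinite zero_neq_numeral)
  then have l: "l \<in> eigenvalues A"
    unfolding l_def using assms(3) by (intro Min_in) auto
  then have "card (eigenvalues A - {l}) = 1" using assms(3) fin by simp
  then obtain m where "eigenvalues A - {l} = {m}" by (auto simp: card_1_singleton_iff)
  with l have ev: "eigenvalues A = {l, m}" and "m \<in> eigenvalues A" "m \<noteq> l" by auto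
  then have lm: "l < m" using Min_le[OF fin, of m] by (simp add: l_def)
  have unit: "norm ((1 / norm v) *\<^sub>R v) = 1" "eigenvector A l ((1 / norm v) *\<^sub>R v)"
    if "eigenvector A l v" for v
    using that by (auto simp: eigenvector_def matrix_vector_mult_scaleR)
  have q: "(A *v x) \<bullet> x = m - (m - l) * (v \<bullet> x)\<^sup>2"
    if "norm v = 1" "eigenvector A l v" "norm x = 1" for v x
    using symmetric_rank_one_decomposition[OF assms(2) ev _ that(2), of x] assms(4) that
    by (simp add: l_def norm_eq_1 algebra_simps)
  show ?thesis
    unfolding l_def[symmetric]
  proof
    assume qc: "spherically_quasi_convex_on (sphere 0 1 \<inter> positive_orthant) (\<lambda>x. (A *v x) \<bullet> x)"
    obtain v where v: "norm v = 1" "eigenvector A l v"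
      using l unit unfolding eigenvalues_def by blast
    show "\<exists>v. eigenvector A l v \<and> (\<forall>i. 0 \<le> v $ i)"
    proof (rule ccontr)
      assume no: "\<nexists>v. eigenvector A l v \<and> (\<forall>i. 0 \<le> v $ i)"
      \<comment> \<open>Since \<open>- v\<close> is an eigenvector too, neither \<open>v\<close> nor
        \<open>- v\<close> is nonnegative, so \<open>v\<close> has entries of both signs.\<close>
      have "eigenvector A l (- v)"
        using v matrix_vector_mult_scaleR[of A "- 1" v] by (simp add: eigenvector_def)
      then have "\<not> (\<forall>i. 0 \<le> v $ i)" "\<not> (\<forall>i. 0 \<le> (- v) $ i)"
        using no v(2) by blast+
      then obtain i j where "0 < v $ i" "0 < (- v) $ j"
        unfolding not_all not_le by auto
      then obtain x y where x: "norm x = 1" "x \<in> positive_orthant" "0 < v \<bullet> x"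
        and y: "norm y = 1" "y \<in> positive_orthant" "0 < (- v) \<bullet> y"
        using inner_pos_point_in_positive_orthant[of v] inner_pos_point_in_positive_orthant[of "- v"]
        by metis
      have "x \<noteq> y" using x y by auto
      then obtain \<gamma> b where \<gamma>: "minimal_geodesic_segment \<gamma> 0 b" "\<gamma> 0 = x" "\<gamma> b = y" "0 \<le> b"
        and cont: "continuous_on {0..b} \<gamma>"
        using minimal_geodesic_segment_exists[of x y] x y inner_pos_of_positive_orthant[of x y]
        by auto
      have "continuous_on {0..b} (\<lambda>t. v \<bullet> \<gamma> t)"
        by (intro continuous_intros cont)
      \<comment> \<open>The function is positive at \<open>x\<close> and negative at
        \<open>y\<close>, so it vanishes somewhere on the arc.\<close>
      then obtain t where t: "t \<in> {0..b}" "v \<bullet> \<gamma> t = 0"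
        using IVT2'[of "\<lambda>t. v \<bullet> \<gamma> t" b 0 0] \<gamma> x y by auto
      have "x \<in> sphere 0 1 \<inter> positive_orthant" "y \<in> sphere 0 1 \<inter> positive_orthant"
        using x y by auto
      then have "\<gamma> ` {0..b} \<subseteq> sphere 0 1 \<inter> positive_orthant"
        using spherically_convex_positive_orthant \<gamma>(1-3) unfolding spherically_convex_def by blast
      then have "(A *v \<gamma> t) \<bullet> \<gamma> t \<le> max ((A *v \<gamma> 0) \<bullet> \<gamma> 0) ((A *v \<gamma> b) \<bullet> \<gamma> b)"
        using qc[unfolded spherically_quasi_convex_on_def, THEN conjunct2, rule_format, of \<gamma> 0 b 0 b t]
          \<gamma> t by simp
      moreover have "(A *v \<gamma> t) \<bullet> \<gamma> t = m"
        using q[OF v norm_minimal_geodesic_segment[OF \<gamma>(1) t(1)]] t by simp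
      \<comment> \<open>At the ends \<open>v\<close> has nonzero inner product, and
        \<open>l < m\<close> puts the form strictly below its maximum.\<close>
      moreover have "(A *v x) \<bullet> x < m" "(A *v y) \<bullet> y < m"
        using q[OF v, of x] q[OF v, of y] x y lm by auto
      ultimately show False using \<gamma> by auto
    qed
  next
    assume "\<exists>v. eigenvector A l v \<and> (\<forall>i. 0 \<le> v $ i)"
    then obtain u where u: "eigenvector A l u" "\<And>i. 0 \<le> u $ i" by blast
    define v where "v = (1 / norm u) *\<^sub>R u"
    have v: "norm v = 1" "eigenvector A l v" and v0: "\<And>i. 0 \<le> v $ i"
      using unit[OF u(1)] u(2) by (auto simp: v_def)
    show "spherically_quasi_convex_on (sphere 0 1 \<inter> positive_orthant) (\<lambda>x. (A *v x) \<bullet> x)"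
      unfolding spherically_quasi_convex_on_def
    proof (intro conjI spherically_convex_positive_orthant allI impI ballI)
      fix \<gamma> :: "real \<Rightarrow> real^'n" and a b t1 t2 t
      assume "minimal_geodesic_segment \<gamma> a b \<and> \<gamma> ` {a..b} \<subseteq> sphere 0 1 \<inter> positive_orthant"
        and ts: "t1 \<in> {a..b}" "t2 \<in> {a..b}" "t \<in> {t1..t2}"
      then have geo: "minimal_geodesic_segment \<gamma> a b"
        and sub: "\<gamma> ` {a..b} \<subseteq> sphere 0 1 \<inter> positive_orthant" by auto
      have C: "norm (\<gamma> s) = 1 \<and> \<gamma> s \<in> positive_orthant" if "s \<in> {a..b}" for s
      proof -
        have "\<gamma> s \<in> sphere 0 1 \<inter> positive_orthant" using sub that by blast
        then show ?thesis by simp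
      qed
      have tab: "t \<in> {a..b}" using ts by auto
      have "0 < \<gamma> a \<bullet> \<gamma> b"
        using C ts by (intro inner_pos_of_positive_orthant) auto
      then obtain \<alpha> \<beta> where *: "0 \<le> \<alpha>" "0 \<le> \<beta>" "1 \<le> \<alpha> + \<beta>"
        "\<gamma> t = \<alpha> *\<^sub>R \<gamma> t1 + \<beta> *\<^sub>R \<gamma> t2"
        using minimal_geodesic_segment_interpolation[OF geo, of t1 t t2] ts by auto
      have nn: "0 \<le> v \<bullet> \<gamma> s" if "s \<in> {a..b}" for s
        using C[OF that] v0 unfolding inner_vec_def positive_orthant_def
        by (auto intro!: sum_nonneg mult_nonneg_nonneg intro: less_imp_le)
      define w where "w = min (v \<bullet> \<gamma> t1) (v \<bullet> \<gamma> t2)"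
      \<comment> \<open>A factor of at least 1 cannot decrease \<open>w\<close>, which is
        nonnegative because \<open>v\<close> and the points of the orthant are.\<close>
      have "w \<le> (\<alpha> + \<beta>) * w"
        using mult_right_mono[OF *(3), of w] nn ts by (simp add: w_def)
      also have "\<dots> = \<alpha> * w + \<beta> * w" by (rule distrib_right)
      also have "\<dots> \<le> \<alpha> * (v \<bullet> \<gamma> t1) + \<beta> * (v \<bullet> \<gamma> t2)"
        using * by (intro add_mono mult_left_mono) (auto simp: w_def)
      also have "\<dots> = v \<bullet> \<gamma> t" by (simp add: * inner_add_right)
      finally have "v \<bullet> \<gamma> t1 \<le> v \<bullet> \<gamma> t \<or> v \<bullet> \<gamma> t2 \<le> v \<bullet> \<gamma> t" by (auto simp: w_def)
      \<comment> \<open>Squaring preserves the order of nonnegative numbers; as \<open>m - l\<close>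
        is positive, the larger square belongs to the smaller value of the form.\<close>
      then have "(v \<bullet> \<gamma> t1)\<^sup>2 \<le> (v \<bullet> \<gamma> t)\<^sup>2 \<or> (v \<bullet> \<gamma> t2)\<^sup>2 \<le> (v \<bullet> \<gamma> t)\<^sup>2"
        using power_mono nn ts by blast
      then show "(A *v \<gamma> t) \<bullet> \<gamma> t \<le> max ((A *v \<gamma> t1) \<bullet> \<gamma> t1) ((A *v \<gamma> t2) \<bullet> \<gamma> t2)"
        using q[OF v, of "\<gamma> t"] q[OF v, of "\<gamma> t1"] q[OF v, of "\<gamma> t2"] C[OF tab] C[OF ts(1)] C[OF ts(2)] lm
        by (simp add: le_max_iff_disj)
    qed
  qed
qed

end
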